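(* Let $1\le p\le\infty$, let $1<N\in\mathbb{N}$, and suppose that $\{\mathbb{X}_i\mid i=1,\dots,N\}$ is a family of half-open subintervals of $[0,1]$. Further suppose that $\{x_0:=0<x_1<\cdots<x_N:=1\}$ is a partition of $[0,1]$ and that $\{u_i\mid i=1,\dots,N\}$ is a family of affine mappings, with $u_i$ mapping $\mathbb{X}_i$ onto $[x_{i-1},x_i)$ for $i=1,\dots,N-1$, and with $u_N$ mapping $\mathbb{X}_N$ onto $[x_{N-1},x_N)$ and mapping $\mathbb{X}_N^+$ onto $[x_{N-1},x_N]$, where $\mathbb{X}_N^+:=\mathbb{X}_N\cup\{u_N^{-1}(1-)\}$ is $\mathbb{X}_N$ together with its missing endpoint. Let $\lambda_i\in L^p(\mathbb{X}_i,[0,1])$ and $S_i\in L^\infty(\mathbb{X}_i,\mathbb{R})$, $i=1,\dots,N$. The operator $\Phi$ on $L^p[0,1]$ defined by $$\Phi g:=\sum_{i=1}^N(\lambda_i\circ u_i^{-1})\,\chi_{u_i(\mathbb{X}_i)}+\sum_{i=1}^N(S_i\circ u_i^{-1})\cdot(g_i\circ u_i^{-1})\,\chi_{u_i(\mathbb{X}_i)},\qquad g_i=g|_{\mathbb{X}_i},$$ maps $L^p[0,1]$ into itself. Moreover, if $$\begin{cases}\left(\displaystyle\sum_{i=1}^N a_i\,\|S_i\|_{\infty,\mathbb{X}_i}^p\right)^{1/p}<1, & p\in[1,\infty);\\[2mm] \max\{\|S_i\|_{\infty,\mathbb{X}_i}\mid i=1,\dots,N\}<1, & p=\infty,\end{cases}$$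 where $a_i$ denotes the Lipschitz constant of $u_i$, then $\Phi$ is contractive on $L^p[0,1]$ and its unique fixed point $f^*$ is an element of $L^p[0,1]$.
   Context: $L^p[0,1]$ is the Lebesgue space of real-valued functions on $[0,1]$ with its usual norm. $L^p(\mathbb{X}_i,[0,1])$ denotes $L^p$ functions on $\mathbb{X}_i$ with values in $[0,1]$, and $L^\infty(\mathbb{X}_i,\mathbb{R})$ the essentially bounded real-valued functions on $\mathbb{X}_i$; $\|\cdot\|_{\infty,\mathbb{X}_i}$ is the $L^\infty(\mathbb{X}_i)$ norm. $\chi_M$ is the indicator function of $M$; each summand is understood to be $0$ outside $u_i(\mathbb{X}_i)$. The single point $x=1$ (covered by $\mathbb{X}_N^+$) is irrelevant for elements of $L^p$. "Contractive" means Lipschitz with constant $<1$ with respect to the $L^p$ norm. *)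

theory Defs
  imports "HOL-Probability.Essential_Supremum"
begin

text \<open>
  \<open>L\<^sup>p\<close> spaces for an exponent \<open>p\<close> that may be infinite. Elements are represented by
  functions, so equality in \<open>L\<^sup>p\<close> is equality almost everywhere. The real-valued
  \<open>Lp_norm\<close> is only meaningful on \<open>Lp_space\<close>.
\<close>

definition Lp_space :: "'a measure \<Rightarrow> ennreal \<Rightarrow> ('a \<Rightarrow> real) set" where
  "Lp_space M p = {f \<in> borel_measurable M.
     if p = \<infinity> then esssup M (\<lambda>x. ennreal \<bar>f x\<bar>) < \<infinity>
     else integrable M (\<lambda>x. \<bar>f x\<bar> powr enn2real p)}"

definition Lp_norm :: "'a measure \<Rightarrow> ennreal \<Rightarrow> ('a \<Rightarrow> real) \<Rightarrow> real" where
  "Lp_norm M p f =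
     (if p = \<infinity> then enn2real (esssup M (\<lambda>x. ennreal \<bar>f x\<bar>))
      else (LINT x|M. \<bar>f x\<bar> powr enn2real p) powr (1 / enn2real p))"

definition contractive_Lp ::
    "'a measure \<Rightarrow> ennreal \<Rightarrow> (('a \<Rightarrow> real) \<Rightarrow> 'a \<Rightarrow> real) \<Rightarrow> bool" where
  "contractive_Lp M p T \<longleftrightarrow>
     (\<exists>c. 0 \<le> c \<and> c < 1 \<and>
       (\<forall>g\<in>Lp_space M p. \<forall>h\<in>Lp_space M p.
          Lp_norm M p (\<lambda>x. T g x - T h x) \<le> c * Lp_norm M p (\<lambda>x. g x - h x)))"

text \<open>Either endpoint may be the missing one: \<open>u\<^sub>i\<close> is allowed to reverse orientation.\<close>

definition half_open_interval :: "real set \<Rightarrow> bool" where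
  "half_open_interval I \<longleftrightarrow> (\<exists>a b. a < b \<and> (I = {a..<b} \<or> I = {a<..b}))"

definition affine_map :: "(real \<Rightarrow> real) \<Rightarrow> bool" where
  "affine_map u \<longleftrightarrow> (\<exists>a b. \<forall>t. u t = a * t + b)"

definition lipschitz_const :: "real set \<Rightarrow> (real \<Rightarrow> real) \<Rightarrow> real" where
  "lipschitz_const I u = Inf {L. L-lipschitz_on I u}"

text \<open>
  \<open>I\<close> together with \<open>u\<^sup>-\<^sup>1(1-)\<close>, the left-hand limit at 1 of the inverse of \<open>u\<close> on \<open>I\<close>.
\<close>

definition add_endpoint :: "real set \<Rightarrow> (real \<Rightarrow> real) \<Rightarrow> real set" where
  "add_endpoint I u = I \<union> {Lim (at_left 1) (inv_into I u)}"

text \<open>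
  On \<open>u\<^sub>i(X\<^sub>i)\<close> the inverse takes values in \<open>X\<^sub>i\<close>, so only the restriction of \<open>g\<close> to \<open>X\<^sub>i\<close>
  enters the \<open>i\<close>-th summand; off \<open>u\<^sub>i(X\<^sub>i)\<close> the indicator makes that summand 0.
\<close>

definition Read_Bajraktarevic ::
    "nat \<Rightarrow> (nat \<Rightarrow> real set) \<Rightarrow> (nat \<Rightarrow> real \<Rightarrow> real) \<Rightarrow> (nat \<Rightarrow> real \<Rightarrow> real) \<Rightarrow>
     (nat \<Rightarrow> real \<Rightarrow> real) \<Rightarrow> (real \<Rightarrow> real) \<Rightarrow> real \<Rightarrow> real" where
  "Read_Bajraktarevic N X u l S g y =
     (\<Sum>i\<in>{1..N}. l i (inv_into (X i) (u i) y) * indicator (u i ` X i) y) +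
     (\<Sum>i\<in>{1..N}. S i (inv_into (X i) (u i) y) * g (inv_into (X i) (u i) y)
        * indicator (u i ` X i) y)"

end

theory Submission
  imports Defs
begin

text \<open>
  The operator \<open>\<Phi>\<close> cuts the line into pieces: on \<open>u\<^sub>i(X\<^sub>i)\<close> it shows the function
  \<open>\<lambda>\<^sub>i + S\<^sub>i g\<close>, transported from \<open>X\<^sub>i\<close> by the affine map \<open>u\<^sub>i\<close>. The images \<open>u\<^sub>i(X\<^sub>i)\<close>
  are disjoint, so for \<open>p < \<infinity>\<close> the integral of the \<open>p\<close>-th power splits over the pieces, and the
  change of variables \<open>y = u\<^sub>i t\<close> multiplies the \<open>i\<close>-th part by the absolute slope \<open>a\<^sub>i\<close> of
  \<open>u\<^sub>i\<close>, which is its Lipschitz constant. In a difference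
  \<open>\<Phi> g - \<Phi> h\<close> the \<open>\<lambda>\<^sub>i\<close> cancel, whence
  \<open>\<parallel>\<Phi> g - \<Phi> h\<parallel>\<^sup>p = \<Sum>\<^sub>i a\<^sub>i \<integral> \<bar>S\<^sub>i\<bar>\<^sup>p \<bar>g - h\<bar>\<^sup>p \<le> (\<Sum>\<^sub>i a\<^sub>i \<parallel>S\<^sub>i\<parallel>\<^sub>\<infinity>\<^sup>p) \<parallel>g - h\<parallel>\<^sup>p\<close>,
  each integral being over \<open>X\<^sub>i\<close>. The domains \<open>X\<^sub>i\<close> may overlap, and for this reason the integral
  of \<open>\<bar>g - h\<bar>\<^sup>p\<close> over each of them is estimated by the integral over the whole interval. For
  \<open>p = \<infinity>\<close> the largest \<open>\<parallel>S\<^sub>i\<parallel>\<^sub>\<infinity>\<close> takes the place of the sum. Both cases are in \<open>Lp_bound_patch\<close>,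
  which also yields that \<open>\<Phi>\<close> maps \<open>L\<^sup>p\<close> into itself and respects equality almost everywhere.

  The fixed point then comes from Banach's theorem, \<open>contractive_Lp_fixed_point\<close>. It rests on the
  completeness of \<open>L\<^sup>p\<close> in this form: a series whose terms have summable norms converges almost
  everywhere (\<open>AE_summable_Lp\<close>, from Minkowski's inequality and monotone convergence), and a norm
  bound passes to limits almost everywhere (\<open>Lp_bound_limit\<close>, Fatou's lemma).
\<close>

section \<open>Norm bounds in \<open>L\<^sup>p\<close>\<close>

text \<open>
  For \<open>K \<ge> 0\<close> this says that \<open>f\<close> has norm at most \<open>K\<close>, but through the extended integral, which
  is defined for every measurable function. One estimate of that integral thus gives membership
  in \<open>L\<^sup>p\<close> and a bound on the norm at once, with no integrability to check on the way.
\<close>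
definition Lp_bound :: "'a measure \<Rightarrow> ennreal \<Rightarrow> ('a \<Rightarrow> real) \<Rightarrow> real \<Rightarrow> bool" where
  "Lp_bound M p f K \<longleftrightarrow> f \<in> borel_measurable M \<and>
     (if p = \<infinity> then AE x in M. \<bar>f x\<bar> \<le> K
      else (\<integral>\<^sup>+x. ennreal (\<bar>f x\<bar> powr enn2real p) \<partial>M) \<le> ennreal (K powr enn2real p))"

lemma Lp_bound_measurable: "Lp_bound M p f K \<Longrightarrow> f \<in> borel_measurable M"
  by (simp add: Lp_bound_def)

lemma one_le_enn2real:
  assumes "1 \<le> p" "p \<noteq> \<infinity>" shows "1 \<le> enn2real p"
  using enn2real_mono[OF assms(1)] assms(2) by (simp add: less_top)

lemma Lp_bound_iff_norm:
  assumes p: "1 \<le> p" and K: "0 \<le> K"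
  shows "Lp_bound M p f K \<longleftrightarrow> f \<in> Lp_space M p \<and> Lp_norm M p f \<le> K"
proof (cases "f \<in> borel_measurable M")
  case False
  then show ?thesis by (simp add: Lp_bound_def Lp_space_def)
next
  case [measurable]: True
  show ?thesis
  proof (cases "p = \<infinity>")
    case True
    let ?E = "esssup M (\<lambda>x. ennreal \<bar>f x\<bar>)"
    have "(AE x in M. \<bar>f x\<bar> \<le> K) \<longleftrightarrow> ?E \<le> ennreal K"
    proof
      assume "AE x in M. \<bar>f x\<bar> \<le> K"
      then show "?E \<le> ennreal K"
        by (intro esssup_I) (auto simp: ennreal_leI)
    next
      assume E: "?E \<le> ennreal K"
      show "AE x in M. \<bar>f x\<bar> \<le> K"
        using esssup_AE[of "\<lambda>x. ennreal \<bar>f x\<bar>" M]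
      proof eventually_elim
        case (elim x)
        then have "ennreal \<bar>f x\<bar> \<le> ennreal K" using E by (rule order_trans)
        then show ?case using K by (simp add: ennreal_le_iff)
      qed
    qed
    also have "\<dots> \<longleftrightarrow> ?E < \<infinity> \<and> enn2real ?E \<le> K"
      using K by (cases ?E) (auto simp: ennreal_le_iff top_unique)
    finally show ?thesis
      using True by (simp add: Lp_bound_def Lp_space_def Lp_norm_def)
  next
    case False
    let ?q = "enn2real p" and ?I = "\<integral>\<^sup>+x. ennreal (\<bar>f x\<bar> powr enn2real p) \<partial>M"
    have q: "1 \<le> ?q" using p False by (rule one_le_enn2real)
    have int: "integrable M (\<lambda>x. \<bar>f x\<bar> powr ?q) \<longleftrightarrow> ?I < \<infinity>"
      by (simp add: integrable_iff_bounded)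
    have eq: "(LINT x|M. \<bar>f x\<bar> powr ?q) = enn2real ?I"
      by (rule integral_eq_nn_integral) auto
    have root: "r powr (1 / ?q) \<le> K \<longleftrightarrow> r \<le> K powr ?q" if "0 \<le> r" for r
    proof -
      have "r powr (1 / ?q) \<le> K \<longleftrightarrow> (r powr (1 / ?q)) powr ?q \<le> K powr ?q"
        using q K powr_less_mono2[of ?q K "r powr (1 / ?q)"] powr_mono2[of ?q "r powr (1 / ?q)" K]
        by (fastforce simp: not_le[symmetric])
      then show ?thesis using q that by (simp add: powr_powr)
    qed
    have "?I \<le> ennreal (K powr ?q) \<longleftrightarrow> ?I < \<infinity> \<and> enn2real ?I \<le> K powr ?q"
      by (cases ?I) (auto simp: ennreal_le_iff top_unique)
    then show ?thesis
      using False by (simp add: Lp_bound_def Lp_space_def Lp_norm_def int eq root)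
  qed
qed

lemma Lp_norm_nonneg: "0 \<le> Lp_norm M p f"
  by (simp add: Lp_norm_def)

lemma Lp_bound_norm:
  assumes "1 \<le> p" "f \<in> Lp_space M p"
  shows "Lp_bound M p f (Lp_norm M p f)"
  using Lp_bound_iff_norm[OF assms(1) Lp_norm_nonneg] assms(2) by blast

text \<open>
  The bound \<open>0\<close> encodes equality almost everywhere, so a Lipschitz estimate that allows \<open>K = 0\<close>
  also shows that an operator respects the classes of \<open>L\<^sup>p\<close>.
\<close>
lemma Lp_bound_0_iff:
  assumes "1 \<le> p"
  shows "Lp_bound M p f 0 \<longleftrightarrow> f \<in> borel_measurable M \<and> (AE x in M. f x = 0)"
proof (cases "f \<in> borel_measurable M")
  case [measurable]: True
  show ?thesis
    by (auto simp: Lp_bound_def nn_integral_0_iff_AE)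
qed (simp add: Lp_bound_def)

lemma Lp_bound_mono:
  assumes p: "1 \<le> p" and g: "Lp_bound M p g K" and f: "f \<in> borel_measurable M"
    and le: "AE x in M. \<bar>f x\<bar> \<le> \<bar>g x\<bar>" and KL: "0 \<le> K" "K \<le> L"
  shows "Lp_bound M p f L"
proof (cases "p = \<infinity>")
  case True
  have "AE x in M. \<bar>g x\<bar> \<le> K" using g True by (simp add: Lp_bound_def)
  with le have "AE x in M. \<bar>f x\<bar> \<le> L" 
    by eventually_elim (use KL in linarith)
  then show ?thesis using f True by (simp add: Lp_bound_def)
next
  case False
  let ?q = "enn2real p"
  have q: "1 \<le> ?q" using p False by (rule one_le_enn2real)
  have "(\<integral>\<^sup>+x. ennreal (\<bar>f x\<bar> powr ?q) \<partial>M) \<le> (\<integral>\<^sup>+x. ennreal (\<bar>g x\<bar> powr ?q) \<partial>M)"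
    using le by (intro nn_integral_mono_AE, eventually_elim) (use q in \<open>auto intro!: ennreal_leI powr_mono2\<close>)
  also have "\<dots> \<le> ennreal (K powr ?q)" using g False by (simp add: Lp_bound_def)
  also have "\<dots> \<le> ennreal (L powr ?q)"
    using q KL by (intro ennreal_leI powr_mono2) auto
  finally show ?thesis using f False by (simp add: Lp_bound_def)
qed

text \<open>
  Convexity of \<open>x \<mapsto> x\<^sup>q\<close> up to the boundary point \<open>0\<close>, where only \<open>s\<^sup>q \<le> s\<close> for
  \<open>0 \<le> s \<le> 1\<close> remains to be used.
\<close>
lemma powr_convex_nonneg:
  fixes x y t q :: real
  assumes q: "1 \<le> q" and xy: "0 \<le> x" "0 \<le> y" and t: "0 \<le> t" "t \<le> 1"
  shows "(t * x + (1 - t) * y) powr q \<le> t * x powr q + (1 - t) * y powr q"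
proof -
  have scale: "(s * z) powr q \<le> s * z powr q" if "0 \<le> s" "s \<le> 1" "0 \<le> z" for s z :: real
  proof -
    have "s powr q \<le> s"
      using that q powr_mono'[of 1 q s] by simp
    then show ?thesis using that by (simp add: powr_mult mult_right_mono)
  qed
  consider "x = 0" | "y = 0" | "0 < x" "0 < y" using xy by linarith
  then show ?thesis
  proof cases
    case 1
    then show ?thesis using scale[of "1 - t" y] q t xy by simp
  next
    case 2
    then show ?thesis using scale[of t x] q t xy by simp
  next
    case 3
    then show ?thesis
      using convex_onD[OF powr_convex[OF q], of "1 - t" x y] t by simp
  qed
qed

text \<open>
  Minkowski's inequality. The number \<open>(\<bar>f\<bar> + \<bar>g\<bar>) / (A + B)\<close> is the convex combination of
  \<open>\<bar>f\<bar> / A\<close> and \<open>\<bar>g\<bar> / B\<close> with weights \<open>A / (A + B)\<close> and \<open>B / (A + B)\<close>. Taking \<open>q\<close>-th powers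
  by convexity and integrating leaves the sum of the weights, that is, \<open>1\<close>. A vanishing bound has
  to be treated apart, and then one of the functions is \<open>0\<close> almost everywhere.
\<close>
lemma Lp_bound_add:
  assumes p: "1 \<le> p" and f: "Lp_bound M p f A" and g: "Lp_bound M p g B"
    and AB: "0 \<le> A" "0 \<le> B"
  shows "Lp_bound M p (\<lambda>x. f x + g x) (A + B)"
proof -
  have [measurable]: "f \<in> borel_measurable M" "g \<in> borel_measurable M"
    using f g by (auto simp: Lp_bound_def)
  consider "A = 0" | "B = 0" | "p = \<infinity>" | "p \<noteq> \<infinity>" "0 < A" "0 < B"
    using AB by linarith
  then show ?thesis
  proof cases
    case 1
    then have "AE x in M. f x = 0" using f Lp_bound_0_iff[OF p] by blast
    then have "AE x in M. \<bar>f x + g x\<bar> \<le> \<bar>g x\<bar>" by eventually_elim simp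
    then show ?thesis using 1 AB by (intro Lp_bound_mono[OF p g]) auto
  next
    case 2
    then have "AE x in M. g x = 0" using g Lp_bound_0_iff[OF p] by blast
    then have "AE x in M. \<bar>f x + g x\<bar> \<le> \<bar>f x\<bar>" by eventually_elim simp
    then show ?thesis using 2 AB by (intro Lp_bound_mono[OF p f]) auto
  next
    case 3
    then have "AE x in M. \<bar>f x\<bar> \<le> A" "AE x in M. \<bar>g x\<bar> \<le> B"
      using f g by (auto simp: Lp_bound_def)
    then have "AE x in M. \<bar>f x + g x\<bar> \<le> A + B" by eventually_elim linarith
    then show ?thesis using 3 by (simp add: Lp_bound_def)
  next
    case 4
    let ?q = "enn2real p" and ?t = "A / (A + B)"
    have q: "1 \<le> ?q" using p 4(1) by (rule one_le_enn2real)
    define \<alpha> where "\<alpha> = (A + B) powr ?q * ?t / A powr ?q"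
    define \<beta> where "\<beta> = (A + B) powr ?q * (1 - ?t) / B powr ?q"
    have nonneg: "0 \<le> \<alpha>" "0 \<le> \<beta>" using 4 by (auto simp: \<alpha>_def \<beta>_def)
    have "\<bar>f x + g x\<bar> powr ?q \<le> \<alpha> * \<bar>f x\<bar> powr ?q + \<beta> * \<bar>g x\<bar> powr ?q" for x
    proof -
      have eq: "\<bar>f x\<bar> + \<bar>g x\<bar> = (A + B) * (?t * (\<bar>f x\<bar> / A) + (1 - ?t) * (\<bar>g x\<bar> / B))"
      proof -
        have "1 - ?t = B / (A + B)" using 4 by (simp add: field_simps)
        then show ?thesis using 4 by (simp add: distrib_left)
      qed
      have "\<bar>f x + g x\<bar> powr ?q \<le> (\<bar>f x\<bar> + \<bar>g x\<bar>) powr ?q"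
        using q by (intro powr_mono2) auto
      also have "\<dots> = (A + B) powr ?q * (?t * (\<bar>f x\<bar> / A) + (1 - ?t) * (\<bar>g x\<bar> / B)) powr ?q"
        unfolding eq using 4 by (subst powr_mult) auto
      also have "\<dots> \<le> (A + B) powr ?q *
          (?t * (\<bar>f x\<bar> / A) powr ?q + (1 - ?t) * (\<bar>g x\<bar> / B) powr ?q)"
        using 4 q by (intro mult_left_mono powr_convex_nonneg) auto
      also have "\<dots> = \<alpha> * \<bar>f x\<bar> powr ?q + \<beta> * \<bar>g x\<bar> powr ?q"
        using 4 by (simp add: \<alpha>_def \<beta>_def powr_divide algebra_simps)
      finally show ?thesis .
    qed
    then have "(\<integral>\<^sup>+x. ennreal (\<bar>f x + g x\<bar> powr ?q) \<partial>M) \<le>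
        (\<integral>\<^sup>+x. ennreal \<alpha> * ennreal (\<bar>f x\<bar> powr ?q) + ennreal \<beta> * ennreal (\<bar>g x\<bar> powr ?q) \<partial>M)"
      using nonneg
      by (intro nn_integral_mono) (simp add: ennreal_leI flip: ennreal_mult ennreal_plus)
    also have "\<dots> = ennreal \<alpha> * (\<integral>\<^sup>+x. ennreal (\<bar>f x\<bar> powr ?q) \<partial>M) +
        ennreal \<beta> * (\<integral>\<^sup>+x. ennreal (\<bar>g x\<bar> powr ?q) \<partial>M)"
      by (simp add: nn_integral_add nn_integral_cmult)
    also have "\<dots> \<le> ennreal \<alpha> * ennreal (A powr ?q) + ennreal \<beta> * ennreal (B powr ?q)"
      using f g 4 by (intro add_mono mult_left_mono) (auto simp: Lp_bound_def)
    also have "\<dots> = ennreal (\<alpha> * A powr ?q + \<beta> * B powr ?q)"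
      using nonneg by (simp flip: ennreal_mult ennreal_plus)
    also have "\<alpha> * A powr ?q + \<beta> * B powr ?q = (A + B) powr ?q * (?t + (1 - ?t))"
      using 4 unfolding \<alpha>_def \<beta>_def distrib_left by simp
    also have "\<dots> = (A + B) powr ?q" by simp
    finally show ?thesis using 4 by (simp add: Lp_bound_def)
  qed
qed

lemma Lp_bound_uminus: "Lp_bound M p f K \<Longrightarrow> Lp_bound M p (\<lambda>x. - f x) K"
  by (simp add: Lp_bound_def)

lemma Lp_bound_diff:
  assumes "1 \<le> p" "Lp_bound M p f A" "Lp_bound M p g B" "0 \<le> A" "0 \<le> B"
  shows "Lp_bound M p (\<lambda>x. f x - g x) (A + B)"
  using Lp_bound_add[OF assms(1,2) Lp_bound_uminus[OF assms(3)]] assms(4,5) by simp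

lemma Lp_bound_sum:
  assumes p: "1 \<le> p" and "finite I"
    and "\<And>i. i \<in> I \<Longrightarrow> Lp_bound M p (f i) (K i)" "\<And>i. i \<in> I \<Longrightarrow> 0 \<le> K i"
  shows "Lp_bound M p (\<lambda>x. \<Sum>i\<in>I. f i x) (\<Sum>i\<in>I. K i)"
  using assms(2-)
proof (induction I)
  case empty
  then show ?case using Lp_bound_0_iff[OF p, of M "\<lambda>x. 0"] by simp
next
  case (insert i I)
  then show ?case by (auto intro!: Lp_bound_add[OF p] sum_nonneg)
qed

lemma Lp_space_iff_bound:
  assumes "1 \<le> p"
  shows "f \<in> Lp_space M p \<longleftrightarrow> (\<exists>K\<ge>0. Lp_bound M p f K)"
  using Lp_bound_iff_norm[OF assms] Lp_bound_norm[OF assms] Lp_norm_nonneg by metis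

lemma Lp_space_diff:
  assumes "1 \<le> p" "f \<in> Lp_space M p" "g \<in> Lp_space M p"
  shows "(\<lambda>x. f x - g x) \<in> Lp_space M p"
proof -
  obtain A B where "0 \<le> A" "Lp_bound M p f A" "0 \<le> B" "Lp_bound M p g B"
    using assms by (auto simp: Lp_space_iff_bound)
  then show ?thesis
    using Lp_bound_diff[OF assms(1)] unfolding Lp_space_iff_bound[OF assms(1)]
    by (intro exI[of _ "A + B"]) auto
qed

lemma Lp_bound_restrict_mono:
  assumes d: "Lp_bound (restrict_space M A) p d K" and "A \<in> sets M" "B \<in> sets M" "B \<subseteq> A"
  shows "Lp_bound (restrict_space M B) p d K"
proof -
  have meas: "d \<in> borel_measurable (restrict_space M B)"
    using Lp_bound_measurable[OF d] assms(4) by (rule measurable_restrict_mono)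
  have AB: "A \<inter> space M \<in> sets M" "B \<inter> space M \<in> sets M" using assms by auto
  show ?thesis
  proof (cases "p = \<infinity>")
    case True
    then have "AE x in M. x \<in> A \<longrightarrow> \<bar>d x\<bar> \<le> K"
      using d by (simp add: Lp_bound_def AE_restrict_space_iff[OF AB(1)])
    then have "AE x in M. x \<in> B \<longrightarrow> \<bar>d x\<bar> \<le> K"
      by eventually_elim (use assms(4) in auto)
    then show ?thesis using True meas by (simp add: Lp_bound_def AE_restrict_space_iff[OF AB(2)])
  next
    case False
    have "(\<integral>\<^sup>+x. ennreal (\<bar>d x\<bar> powr enn2real p) \<partial>restrict_space M B) \<le>
        (\<integral>\<^sup>+x. ennreal (\<bar>d x\<bar> powr enn2real p) \<partial>restrict_space M A)"
      unfolding nn_integral_restrict_space[OF AB(1)] nn_integral_restrict_space[OF AB(2)]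
      using assms(4) by (intro nn_integral_mono) (auto simp: indicator_def)
    then show ?thesis using False d meas by (auto simp: Lp_bound_def)
  qed
qed

lemma Lp_bound_mult:
  assumes p: "1 \<le> p" and S: "S \<in> borel_measurable M" "AE x in M. \<bar>S x\<bar> \<le> s" "0 \<le> s"
    and d: "Lp_bound M p d K" "0 \<le> K"
  shows "Lp_bound M p (\<lambda>x. S x * d x) (s * K)"
proof -
  have [measurable]: "d \<in> borel_measurable M" "S \<in> borel_measurable M" using d S by (auto simp: Lp_bound_def)
  have scaled: "Lp_bound M p (\<lambda>x. s * d x) (s * K)"
  proof (cases "p = \<infinity>")
    case True
    then have "AE x in M. \<bar>d x\<bar> \<le> K" using d by (simp add: Lp_bound_def)
    then have "AE x in M. \<bar>s * d x\<bar> \<le> s * K"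
      by eventually_elim (use S(3) in \<open>simp add: abs_mult mult_left_mono\<close>)
    then show ?thesis using True by (simp add: Lp_bound_def)
  next
    case False
    let ?q = "enn2real p"
    have "(\<integral>\<^sup>+x. ennreal (\<bar>s * d x\<bar> powr ?q) \<partial>M) =
        (\<integral>\<^sup>+x. ennreal (s powr ?q) * ennreal (\<bar>d x\<bar> powr ?q) \<partial>M)"
      using S(3) by (simp add: abs_mult powr_mult flip: ennreal_mult)
    also have "\<dots> = ennreal (s powr ?q) * (\<integral>\<^sup>+x. ennreal (\<bar>d x\<bar> powr ?q) \<partial>M)"
      by (rule nn_integral_cmult) simp
    also have "\<dots> \<le> ennreal (s powr ?q) * ennreal (K powr ?q)"
      using d False by (intro mult_left_mono) (auto simp: Lp_bound_def)
    also have "\<dots> = ennreal ((s * K) powr ?q)"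
      using S(3) d(2) by (simp add: powr_mult flip: ennreal_mult)
    finally show ?thesis using False by (simp add: Lp_bound_def)
  qed
  moreover have "AE x in M. \<bar>S x * d x\<bar> \<le> \<bar>s * d x\<bar>"
    using S(2) by eventually_elim (use S(3) in \<open>simp add: abs_mult mult_right_mono\<close>)
  ultimately show ?thesis
    using S(3) d(2) by (intro Lp_bound_mono[OF p scaled]) auto
qed

section \<open>Completeness and contractions\<close>

text \<open>Closed balls of \<open>L\<^sup>p\<close> are closed under limits almost everywhere, by Fatou's lemma.\<close>
lemma Lp_bound_limit:
  assumes p: "1 \<le> p" and f: "\<And>n. Lp_bound M p (f n) K"
    and g: "g \<in> borel_measurable M" and lim: "AE x in M. (\<lambda>n. f n x) \<longlonglongrightarrow> g x"
  shows "Lp_bound M p g K"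
proof -
  have [measurable]: "\<And>n. f n \<in> borel_measurable M" "g \<in> borel_measurable M"
    using f g by (auto simp: Lp_bound_def)
  show ?thesis
  proof (cases "p = \<infinity>")
    case True
    have "AE x in M. \<forall>n. \<bar>f n x\<bar> \<le> K"
      using f True by (auto simp: Lp_bound_def AE_all_countable)
    with lim have "AE x in M. \<bar>g x\<bar> \<le> K"
    proof eventually_elim
      case (elim x)
      then show ?case
        by (intro LIMSEQ_le_const2[OF tendsto_rabs]) auto
    qed
    then show ?thesis using True g by (simp add: Lp_bound_def)
  next
    case False
    let ?q = "enn2real p"
    have q: "1 \<le> ?q" using p False by (rule one_le_enn2real)
    have "(\<integral>\<^sup>+x. ennreal (\<bar>g x\<bar> powr ?q) \<partial>M) =
        (\<integral>\<^sup>+x. liminf (\<lambda>n. ennreal (\<bar>f n x\<bar> powr ?q)) \<partial>M)"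
    proof (rule nn_integral_cong_AE)
      show "AE x in M. ennreal (\<bar>g x\<bar> powr ?q) = liminf (\<lambda>n. ennreal (\<bar>f n x\<bar> powr ?q))"
        using lim
      proof eventually_elim
        case (elim x)
        have "(\<lambda>n. \<bar>f n x\<bar> powr ?q) \<longlonglongrightarrow> \<bar>g x\<bar> powr ?q"
          using elim q by (intro tendsto_powr' tendsto_rabs tendsto_const) auto
        then have "(\<lambda>n. ennreal (\<bar>f n x\<bar> powr ?q)) \<longlonglongrightarrow> ennreal (\<bar>g x\<bar> powr ?q)"
          by (rule tendsto_ennrealI)
        then show ?case by (simp add: lim_imp_Liminf del: tendsto_ennreal_iff)
      qed
    qed
    also have "\<dots> \<le> liminf (\<lambda>n. \<integral>\<^sup>+x. ennreal (\<bar>f n x\<bar> powr ?q) \<partial>M)"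
      by (rule nn_integral_liminf) simp
    also have "\<dots> \<le> ennreal (K powr ?q)"
      using f False by (intro Liminf_le) (auto simp: Lp_bound_def)
    finally show ?thesis using False g by (simp add: Lp_bound_def)
  qed
qed

text \<open>
  This is the heart of the completeness of \<open>L\<^sup>p\<close>. By Minkowski's inequality the increasing partial
  sums of \<open>\<bar>f\<^sub>n\<bar>\<close> stay in one ball; by monotone convergence so does their supremum, which is
  therefore finite almost everywhere.
\<close>
lemma AE_summable_Lp:
  assumes p: "1 \<le> p" and f: "\<And>n. Lp_bound M p (f n) (K n)"
    and K: "\<And>n. 0 \<le> K n" "summable K"
  shows "AE x in M. summable (\<lambda>n. f n x)"
proof -
  have [measurable]: "\<And>n. f n \<in> borel_measurable M"
    using f by (auto simp: Lp_bound_def)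
  define s where "s n x = (\<Sum>k<n. \<bar>f k x\<bar>)" for n x
  have [measurable]: "\<And>n. s n \<in> borel_measurable M" unfolding s_def by measurable
  have s_bound: "Lp_bound M p (s n) (suminf K)" for n
  proof -
    have "Lp_bound M p (\<lambda>x. \<bar>f k x\<bar>) (K k)" for k
      using K by (intro Lp_bound_mono[OF p f]) auto
    then have "Lp_bound M p (s n) (\<Sum>k<n. K k)"
      unfolding s_def using K by (intro Lp_bound_sum[OF p]) auto
    then show ?thesis
      using K by (rule_tac Lp_bound_mono[OF p]) (auto intro!: sum_nonneg sum_le_suminf)
  qed
  have s_mono: "incseq (\<lambda>n. s n x)" for x
    by (rule incseq_SucI) (simp add: s_def)
  have s_nonneg: "0 \<le> s n x" for n x by (simp add: s_def sum_nonneg)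
  have "AE x in M. \<exists>B. \<forall>n. s n x \<le> B"
  proof (cases "p = \<infinity>")
    case True
    have "AE x in M. \<forall>n. s n x \<le> suminf K"
      using s_bound True by (simp add: Lp_bound_def AE_all_countable s_nonneg)
    then show ?thesis by eventually_elim blast
  next
    case False
    let ?q = "enn2real p"
    have q: "1 \<le> ?q" using p False by (rule one_le_enn2real)
    have "(\<integral>\<^sup>+x. (SUP n. ennreal (s n x powr ?q)) \<partial>M) = (SUP n. \<integral>\<^sup>+x. ennreal (s n x powr ?q) \<partial>M)"
      using s_mono q s_nonneg
      by (intro nn_integral_monotone_convergence_SUP)
         (auto simp: incseq_def le_fun_def intro!: ennreal_leI powr_mono2)
    also have "\<dots> \<le> ennreal (suminf K powr ?q)"
      using s_bound False by (auto simp: Lp_bound_def s_nonneg intro!: SUP_least)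
    finally have "(\<integral>\<^sup>+x. (SUP n. ennreal (s n x powr ?q)) \<partial>M) \<noteq> \<infinity>"
      by (auto simp: top_unique)
    then have "AE x in M. (SUP n. ennreal (s n x powr ?q)) \<noteq> \<infinity>"
      by (intro nn_integral_PInf_AE) auto
    then show ?thesis
    proof eventually_elim
      case (elim x)
      then obtain r where r: "0 \<le> r" "(SUP n. ennreal (s n x powr ?q)) = ennreal r"
        by (cases "SUP n. ennreal (s n x powr ?q)") auto
      have "s n x \<le> r powr (1 / ?q)" for n
      proof -
        have "ennreal (s n x powr ?q) \<le> ennreal r"
          unfolding r(2)[symmetric] by (rule SUP_upper) simp
        then have "s n x powr ?q \<le> r" using r(1) by (simp add: ennreal_le_iff)
        then have "(s n x powr ?q) powr (1 / ?q) \<le> r powr (1 / ?q)"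
          using q by (intro powr_mono2) auto
        then show ?thesis using q s_nonneg[of n x] by (simp add: powr_powr)
      qed
      then show ?case by blast
    qed
  qed
  then show ?thesis
  proof eventually_elim
    case (elim x)
    then obtain B where "s n x \<le> B" for n by blast
    then have "(\<Sum>k\<le>n. \<bar>f k x\<bar>) \<le> B" for n
      by (metis s_def lessThan_Suc_atMost)
    then have "summable (\<lambda>n. \<bar>f n x\<bar>)"
      by (intro bounded_imp_summable[where B = B]) auto
    then show ?case by (rule summable_rabs_cancel)
  qed
qed

text \<open>
  Banach's fixed point theorem. The increments of the iterates \<open>F\<^sub>n = T\<^sup>n 0\<close> have norms at most
  \<open>D c\<^sup>n\<close>, so the iterates converge almost everywhere, and Fatou's lemma turns the geometric bound
  on \<open>F\<^sub>m - F\<^sub>n\<close> into one on \<open>f - F\<^sub>n\<close>. As \<open>T\<close> is only known to be continuous in norm, the limit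
  is recognised as a fixed point by comparing \<open>T f\<close> and \<open>f\<close> in norm with \<open>T F\<^sub>n = F\<^sub>n\<^sub>+\<^sub>1\<close>.
\<close>
lemma contractive_Lp_fixed_point:
  assumes p: "1 \<le> p" and maps: "\<And>g. g \<in> Lp_space M p \<Longrightarrow> T g \<in> Lp_space M p"
    and contr: "contractive_Lp M p T"
  shows "\<exists>f\<in>Lp_space M p. (AE x in M. T f x = f x) \<and>
           (\<forall>h\<in>Lp_space M p. (AE x in M. T h x = h x) \<longrightarrow> (AE x in M. h x = f x))"
proof -
  obtain c where c: "0 \<le> c" "c < 1" and lip: "\<And>g h. g \<in> Lp_space M p \<Longrightarrow> h \<in> Lp_space M p \<Longrightarrow>
      Lp_norm M p (\<lambda>x. T g x - T h x) \<le> c * Lp_norm M p (\<lambda>x. g x - h x)"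
    using contr by (auto simp: contractive_Lp_def)
  have lip_bound: "Lp_bound M p (\<lambda>x. T g x - T h x) (c * K)"
    if "g \<in> Lp_space M p" "h \<in> Lp_space M p" "0 \<le> K" "Lp_bound M p (\<lambda>x. g x - h x) K" for g h K
  proof -
    have "Lp_norm M p (\<lambda>x. T g x - T h x) \<le> c * K"
      using lip[OF that(1,2)] mult_left_mono[of _ K c] c that Lp_bound_iff_norm[OF p that(3)]
      by (meson order_trans)
    then show ?thesis
      using that c by (simp add: Lp_bound_iff_norm[OF p] Lp_space_diff[OF p] maps)
  qed
  define F where "F n = (T ^^ n) (\<lambda>_. 0)" for n
  have F_Suc: "F (Suc n) = T (F n)" for n by (simp add: F_def)
  have F_Lp: "F n \<in> Lp_space M p" for n
  proof (induction n)
    case 0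
    then show ?case using Lp_bound_0_iff[OF p, of M "\<lambda>_. 0"]
      by (auto simp: F_def Lp_space_iff_bound[OF p])
  qed (simp add: F_Suc maps)
  then have [measurable]: "\<And>n. F n \<in> borel_measurable M" by (simp add: Lp_space_def)
  define d where "d n x = F (Suc n) x - F n x" for n x
  have [measurable]: "\<And>n. d n \<in> borel_measurable M" unfolding d_def by measurable
  define D where "D = Lp_norm M p (d 0)"
  have D: "0 \<le> D" by (simp add: D_def Lp_norm_nonneg)
  have d_bound: "Lp_bound M p (d n) (D * c ^ n)" for n
  proof (induction n)
    case 0
    have "d 0 \<in> Lp_space M p" unfolding d_def[abs_def] using Lp_space_diff[OF p F_Lp F_Lp] .
    then show ?case using Lp_bound_norm[OF p] by (simp add: D_def)
  next
    case (Suc n)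
    then show ?case
      using lip_bound[OF F_Lp F_Lp, of "D * c ^ n" "Suc n" n] c D
      by (simp add: d_def[abs_def] F_Suc mult_ac)
  qed
  have geo: "summable (\<lambda>n. D * c ^ n)" using c by (intro summable_mult summable_geometric) simp
  have summable_d: "AE x in M. summable (\<lambda>n. d n x)"
    using c D by (intro AE_summable_Lp[OF p d_bound _ geo]) auto
  define f where "f x = F 0 x + (\<Sum>n. d n x)" for x
  have [measurable]: "f \<in> borel_measurable M" unfolding f_def by measurable
  have F_diff: "F (n + m) x - F n x = (\<Sum>k<m. d (n + k) x)" for n m x
    by (induction m) (auto simp: d_def)
  have F_tendsto: "AE x in M. (\<lambda>n. F n x) \<longlonglongrightarrow> f x"
    using summable_d
  proof eventually_elim
    case (elim x)
    have "F 0 x + (\<Sum>k<n. d k x) = F n x" for n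
      using F_diff[of 0 n x] by simp
    moreover have "(\<lambda>n. F 0 x + (\<Sum>k<n. d k x)) \<longlonglongrightarrow> f x"
      unfolding f_def by (intro tendsto_intros summable_LIMSEQ elim)
    ultimately show ?case by (simp only:)
  qed
  \<comment> \<open>The tail \<open>D c\<^sup>n + D c\<^sup>n\<^sup>+\<^sup>1 + \<dots>\<close> of the geometric series.\<close>
  define E where "E n = D / (1 - c) * c ^ n" for n
  have E_nonneg: "0 \<le> E n" for n using c D by (simp add: E_def)
  have tail: "Lp_bound M p (\<lambda>x. f x - F n x) (E n)" for n
  proof (rule Lp_bound_limit[OF p])
    show "Lp_bound M p (\<lambda>x. F (n + m) x - F n x) (E n)" for m
    proof -
      have "Lp_bound M p (\<lambda>x. \<Sum>k<m. d (n + k) x) (\<Sum>k<m. D * c ^ (n + k))"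
        using c D by (intro Lp_bound_sum[OF p] d_bound) auto
      moreover have "(\<Sum>k<m. D * c ^ (n + k)) \<le> E n"
      proof -
        have "(\<Sum>k<m. D * c ^ (n + k)) = D * c ^ n * (\<Sum>k<m. c ^ k)"
          by (simp add: sum_distrib_left power_add mult_ac)
        also have "\<dots> \<le> D * c ^ n * (\<Sum>k. c ^ k)"
          using c D by (intro mult_left_mono sum_le_suminf) (auto intro: summable_geometric)
        also have "\<dots> = E n" using c by (simp add: suminf_geometric E_def)
        finally show ?thesis .
      qed
      ultimately show ?thesis
        unfolding F_diff using c D by (rule_tac Lp_bound_mono[OF p]) (auto intro!: sum_nonneg)
    qed
    show "AE x in M. (\<lambda>m. F (n + m) x - F n x) \<longlonglongrightarrow> f x - F n x"
      using F_tendsto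
    proof eventually_elim
      case (elim x)
      have "(\<lambda>m. F (n + m) x) \<longlonglongrightarrow> f x"
        using LIMSEQ_ignore_initial_segment[OF elim, of n] by (simp add: add.commute)
      then show ?case by (intro tendsto_intros)
    qed
  qed simp
  have f_Lp: "f \<in> Lp_space M p"
    using Lp_bound_add[OF p tail[of 0] Lp_bound_norm[OF p F_Lp[of 0]] E_nonneg Lp_norm_nonneg]
      E_nonneg[of 0] Lp_norm_nonneg[of M p "F 0"]
    by (auto simp: Lp_space_iff_bound[OF p] intro!: exI[of _ "E 0 + Lp_norm M p (F 0)"])
  have "AE x in M. T f x = f x"
  proof -
    have bound: "Lp_norm M p (\<lambda>x. T f x - f x) \<le> c * E n + E (Suc n)" for n
    proof -
      have "Lp_bound M p (\<lambda>x. (T f x - T (F n) x) - (f x - F (Suc n) x)) (c * E n + E (Suc n))"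
        using c E_nonneg by (intro Lp_bound_diff[OF p] lip_bound f_Lp F_Lp tail) auto
      then show ?thesis
        using c E_nonneg by (simp add: F_Suc Lp_bound_iff_norm[OF p])
    qed
    have "E \<longlonglongrightarrow> 0"
      unfolding E_def using c by (intro tendsto_mult_right_zero LIMSEQ_power_zero) simp
    then have "(\<lambda>n. c * E n + E (Suc n)) \<longlonglongrightarrow> c * 0 + 0"
      by (intro tendsto_intros LIMSEQ_Suc)
    then have "Lp_norm M p (\<lambda>x. T f x - f x) \<le> 0"
      using bound by (intro LIMSEQ_le_const[of _ 0]) auto
    then have "Lp_bound M p (\<lambda>x. T f x - f x) 0"
      by (simp add: Lp_bound_iff_norm[OF p] Lp_space_diff[OF p] maps f_Lp)
    then show ?thesis by (simp add: Lp_bound_0_iff[OF p])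
  qed
  moreover have "AE x in M. h x = f x" if h: "h \<in> Lp_space M p" "AE x in M. T h x = h x" for h
  proof -
    let ?K = "Lp_norm M p (\<lambda>x. h x - f x)"
    have K: "0 \<le> ?K" "Lp_bound M p (\<lambda>x. h x - f x) ?K"
      using Lp_bound_norm[OF p Lp_space_diff[OF p h(1) f_Lp]] by (auto simp: Lp_norm_nonneg)
    have [measurable]: "h \<in> borel_measurable M" using h(1) by (simp add: Lp_space_def)
    have "AE x in M. \<bar>h x - f x\<bar> \<le> \<bar>T h x - T f x\<bar>"
      using h(2) \<open>AE x in M. T f x = f x\<close> by eventually_elim simp
    then have "Lp_bound M p (\<lambda>x. h x - f x) (c * ?K)"
      using K c by (intro Lp_bound_mono[OF p lip_bound[OF h(1) f_Lp K]]) auto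
    then have "?K \<le> c * ?K"
      using K c by (simp add: Lp_bound_iff_norm[OF p])
    then have "(1 - c) * ?K \<le> 0" by (simp add: algebra_simps)
    then have "?K = 0" using K(1) c by (simp add: mult_le_0_iff)
    then show ?thesis using K(2) by (simp add: Lp_bound_0_iff[OF p])
  qed
  ultimately show ?thesis using f_Lp by blast
qed

section \<open>Gluing functions along affine maps\<close>

lemma lipschitz_const_affine:
  assumes u: "\<And>t. u t = a * t + b" and st: "s \<in> I" "t \<in> I" "s \<noteq> t"
  shows "lipschitz_const I u = \<bar>a\<bar>"
proof -
  have dist: "dist (u y) (u z) = \<bar>a\<bar> * dist y z" for y z
  proof -
    have "u y - u z = a * (y - z)" by (simp add: u algebra_simps)
    then show ?thesis by (simp add: dist_real_def abs_mult)
  qed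
  have "{L. L-lipschitz_on I u} = {\<bar>a\<bar>..}"
  proof (intro set_eqI iffI; clarsimp)
    fix L assume "L-lipschitz_on I u"
    then have "\<bar>a\<bar> * dist s t \<le> L * dist s t"
      using lipschitz_onD[of L I u s t] st by (simp add: dist)
    then show "\<bar>a\<bar> \<le> L" using st by simp
  next
    fix L assume "\<bar>a\<bar> \<le> L"
    then show "L-lipschitz_on I u"
      by (intro lipschitz_onI) (auto simp: dist intro: mult_right_mono)
  qed
  then show ?thesis by (simp add: lipschitz_const_def)
qed

text \<open>
  Disjointness of the images lets the pieces be estimated one by one, since no point then sees two
  of them. The domains \<open>X\<^sub>i\<close> may overlap, and a slope \<open>a\<^sub>i\<close> may be negative.
\<close>
locale affine_pieces =
  fixes I :: "'i set" and X :: "'i \<Rightarrow> real set" and u :: "'i \<Rightarrow> real \<Rightarrow> real"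
    and a b :: "'i \<Rightarrow> real"
  assumes I: "finite I" "I \<noteq> {}"
    and X_sets: "\<And>i. i \<in> I \<Longrightarrow> X i \<in> sets lebesgue"
    and affine: "\<And>i t. i \<in> I \<Longrightarrow> u i t = a i * t + b i"
    and slope: "\<And>i. i \<in> I \<Longrightarrow> a i \<noteq> 0"
    and disjoint: "disjoint_family_on (\<lambda>i. u i ` X i) I"
begin

text \<open>
  The functions \<open>H\<^sub>i\<close> on \<open>X\<^sub>i\<close>, transported by \<open>u\<^sub>i\<close> and glued together. The operator
  \<open>\<Phi>\<close> sends \<open>g\<close> to the patch of the functions \<open>\<lambda>\<^sub>i + S\<^sub>i g\<close>.
\<close>
definition patch :: "('i \<Rightarrow> real \<Rightarrow> real) \<Rightarrow> real \<Rightarrow> real" where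
  "patch H y = (\<Sum>i\<in>I. H i (inv_into (X i) (u i) y) * indicator (u i ` X i) y)"

text \<open>
  The bound on the norm of a patch whose pieces have norms at most \<open>s\<^sub>i\<close>. For
  \<open>s\<^sub>i = \<parallel>S\<^sub>i\<parallel>\<^sub>\<infinity>\<close> it is a Lipschitz constant of \<open>\<Phi>\<close>.
\<close>
definition patch_const :: "ennreal \<Rightarrow> ('i \<Rightarrow> real) \<Rightarrow> real" where
  "patch_const p s = (if p = \<infinity> then Max (s ` I)
     else (\<Sum>i\<in>I. \<bar>a i\<bar> * s i powr enn2real p) powr (1 / enn2real p))"

definition piece :: "('i \<Rightarrow> real \<Rightarrow> real) \<Rightarrow> 'i \<Rightarrow> real \<Rightarrow> real" where
  "piece H i t = (if t \<in> X i then H i t else 0)"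

lemma patch_const_nonneg:
  assumes "\<And>i. i \<in> I \<Longrightarrow> 0 \<le> s i"
  shows "0 \<le> patch_const p s"
proof -
  obtain i where "i \<in> I" using I(2) by blast
  then have "0 \<le> Max (s ` I)" using assms I(1) by (meson Max_ge finite_imageI imageI order_trans)
  then show ?thesis by (simp add: patch_const_def)
qed

lemma mem_image_iff:
  assumes "i \<in> I" shows "y \<in> u i ` X i \<longleftrightarrow> (y - b i) / a i \<in> X i"
proof -
  have "y = u i t \<longleftrightarrow> t = (y - b i) / a i" for t
    using slope[OF assms] by (auto simp: affine[OF assms] field_simps)
  then show ?thesis by (simp add: image_iff)
qed

lemma patch_eq: "patch H y = (\<Sum>i\<in>I. piece H i ((y - b i) / a i))"
  unfolding patch_def
proof (rule sum.cong)
  fix i assume i: "i \<in> I"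
  show "H i (inv_into (X i) (u i) y) * indicator (u i ` X i) y = piece H i ((y - b i) / a i)"
  proof (cases "y \<in> u i ` X i")
    case True
    have "inj_on (u i) (X i)" using slope[OF i] by (auto simp: inj_on_def affine[OF i])
    moreover have "u i ((y - b i) / a i) = y" using slope[OF i] by (simp add: affine[OF i])
    moreover have "(y - b i) / a i \<in> X i" using True mem_image_iff[OF i] by simp
    ultimately have "inv_into (X i) (u i) y = (y - b i) / a i"
      using inv_into_f_f by metis
    then show ?thesis using True mem_image_iff[OF i] by (simp add: piece_def)
  qed (simp add: piece_def mem_image_iff[OF i])
qed simp

lemma piece_measurable:
  "i \<in> I \<Longrightarrow> H i \<in> borel_measurable (lebesgue_on (X i)) \<Longrightarrow> piece H i \<in> borel_measurable lebesgue"
  unfolding piece_def by (intro borel_measurable_if_I X_sets)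

lemma inverse_branch_measurable: "i \<in> I \<Longrightarrow> (\<lambda>y. (y - b i) / a i) \<in> lebesgue \<rightarrow>\<^sub>M lebesgue"
  using lebesgue_affine_measurable[of "\<lambda>_. 1 / a i" "- (b i / a i)"] slope[of i]
  by (simp add: diff_divide_distrib)

lemma patch_measurable:
  assumes "\<And>i. i \<in> I \<Longrightarrow> H i \<in> borel_measurable (lebesgue_on (X i))"
  shows "patch H \<in> borel_measurable lebesgue"
  unfolding patch_eq[abs_def]
  by (intro borel_measurable_sum measurable_compose[OF inverse_branch_measurable piece_measurable] assms)

text \<open>
  Each point lies in at most one image, so \<open>\<phi>\<close> of the patch is the sum of \<open>\<phi>\<close> of its summands,
  and the substitution \<open>y = u\<^sub>i t\<close> contributes the factor \<open>\<bar>a\<^sub>i\<bar>\<close>. The function \<open>\<phi>\<close> is left open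
  to serve both the power \<open>\<bar>r\<bar>\<^sup>q\<close> and, for the essential supremum, the indicator of
  \<open>\<bar>r\<bar> > K\<close>.
\<close>
lemma nn_integral_patch:
  assumes H: "\<And>i. i \<in> I \<Longrightarrow> H i \<in> borel_measurable (lebesgue_on (X i))"
    and \<phi>[measurable]: "\<phi> \<in> borel_measurable borel" and \<phi>0: "\<phi> 0 = (0::ennreal)"
  shows "(\<integral>\<^sup>+y. \<phi> (patch H y) \<partial>lebesgue) =
    (\<Sum>i\<in>I. ennreal \<bar>a i\<bar> * (\<integral>\<^sup>+t. \<phi> (H i t) \<partial>lebesgue_on (X i)))"
proof -
  have split: "\<phi> (patch H y) = (\<Sum>i\<in>I. \<phi> (piece H i ((y - b i) / a i)))" for y
  proof (cases "\<exists>j\<in>I. y \<in> u j ` X j")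
    case True
    then obtain j where j: "j \<in> I" "y \<in> u j ` X j" by blast
    have "piece H i ((y - b i) / a i) = 0" if "i \<in> I - {j}" for i
    proof -
      have "y \<notin> u i ` X i" using disjoint that j by (auto simp: disjoint_family_on_def)
      then show ?thesis using that by (simp add: piece_def mem_image_iff)
    qed
    then show ?thesis using I(1) j(1) by (simp add: patch_eq sum.remove[of I j] \<phi>0)
  next
    case False
    then show ?thesis by (simp add: patch_eq piece_def mem_image_iff \<phi>0)
  qed
  have meas: "(\<lambda>t. \<phi> (piece H i t)) \<in> borel_measurable lebesgue" if "i \<in> I" for i
    using piece_measurable[of i H, OF that H[OF that]] by measurable
  have "(\<integral>\<^sup>+y. \<phi> (patch H y) \<partial>lebesgue) =
      (\<Sum>i\<in>I. \<integral>\<^sup>+y. \<phi> (piece H i ((y - b i) / a i)) \<partial>lebesgue)"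
    unfolding split
    by (intro nn_integral_sum measurable_compose[OF inverse_branch_measurable meas])
  also have "\<dots> = (\<Sum>i\<in>I. ennreal \<bar>a i\<bar> * (\<integral>\<^sup>+t. \<phi> (H i t) \<partial>lebesgue_on (X i)))"
  proof (rule sum.cong)
    fix i assume i: "i \<in> I"
    have "(\<integral>\<^sup>+y. \<phi> (piece H i ((y - b i) / a i)) \<partial>lebesgue) =
        ennreal \<bar>a i\<bar> * (\<integral>\<^sup>+t. \<phi> (piece H i (((b i + a i * t) - b i) / a i)) \<partial>lebesgue)"
      by (rule nn_integral_real_affine_lebesgue
          [OF measurable_compose[OF inverse_branch_measurable[OF i] meas[OF i]] slope[OF i]])
    also have "(\<integral>\<^sup>+t. \<phi> (piece H i (((b i + a i * t) - b i) / a i)) \<partial>lebesgue) =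
        (\<integral>\<^sup>+t. \<phi> (H i t) * indicator (X i) t \<partial>lebesgue)"
      using slope[OF i] by (intro nn_integral_cong) (auto simp: piece_def \<phi>0)
    also have "\<dots> = (\<integral>\<^sup>+t. \<phi> (H i t) \<partial>lebesgue_on (X i))"
      using X_sets[OF i] by (simp add: nn_integral_restrict_space)
    finally show "(\<integral>\<^sup>+y. \<phi> (piece H i ((y - b i) / a i)) \<partial>lebesgue) =
        ennreal \<bar>a i\<bar> * (\<integral>\<^sup>+t. \<phi> (H i t) \<partial>lebesgue_on (X i))" .
  qed simp
  finally show ?thesis .
qed

lemma AE_patch:
  assumes H: "\<And>i. i \<in> I \<Longrightarrow> H i \<in> borel_measurable (lebesgue_on (X i))"
    and le: "\<And>i. i \<in> I \<Longrightarrow> AE t in lebesgue_on (X i). \<bar>H i t\<bar> \<le> K" and K: "0 \<le> K"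
  shows "AE y in lebesgue. \<bar>patch H y\<bar> \<le> K"
proof -
  let ?\<phi> = "indicator {r. K < \<bar>r\<bar>} :: real \<Rightarrow> ennreal"
  have [measurable]: "patch H \<in> borel_measurable lebesgue" by (rule patch_measurable[OF H])
  have [measurable]: "?\<phi> \<in> borel_measurable borel" by measurable
  have "(\<integral>\<^sup>+t. ?\<phi> (H i t) \<partial>lebesgue_on (X i)) = 0" if i: "i \<in> I" for i
  proof -
    have [measurable]: "H i \<in> borel_measurable (lebesgue_on (X i))" by (rule H[OF i])
    have "AE t in lebesgue_on (X i). ?\<phi> (H i t) = 0"
      using le[OF i] by eventually_elim simp
    then show ?thesis by (simp add: nn_integral_0_iff_AE)
  qed
  then have "(\<integral>\<^sup>+y. ?\<phi> (patch H y) \<partial>lebesgue) = 0"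
    using K by (subst nn_integral_patch[OF H]) auto
  then have "AE y in lebesgue. ?\<phi> (patch H y) = 0"
    by (subst (asm) nn_integral_0_iff_AE) auto
  then show ?thesis
    by eventually_elim (auto simp: indicator_def split: if_splits)
qed

text \<open>
  The norm estimate behind the theorem. For finite exponents the \<open>q\<close>-th powers of the norms of the
  pieces add up with weights \<open>\<bar>a\<^sub>i\<bar>\<close>; for the supremum norm the worst piece decides.
\<close>
lemma Lp_bound_patch:
  assumes p: "1 \<le> p" and H: "\<And>i. i \<in> I \<Longrightarrow> Lp_bound (lebesgue_on (X i)) p (H i) (s i * K)"
    and s: "\<And>i. i \<in> I \<Longrightarrow> 0 \<le> s i" and K: "0 \<le> K"
  shows "Lp_bound lebesgue p (patch H) (patch_const p s * K)"
proof -
  have meas: "\<And>i. i \<in> I \<Longrightarrow> H i \<in> borel_measurable (lebesgue_on (X i))"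
    using H by (rule Lp_bound_measurable)
  have pm: "patch H \<in> borel_measurable lebesgue" by (rule patch_measurable[OF meas])
  show ?thesis
  proof (cases "p = \<infinity>")
    case True
    have s_le: "s i \<le> patch_const p s" if "i \<in> I" for i
      using True I(1) that by (simp add: patch_const_def)
    have "0 \<le> patch_const p s" using s by (rule patch_const_nonneg)
    have "AE t in lebesgue_on (X i). \<bar>H i t\<bar> \<le> patch_const p s * K" if i: "i \<in> I" for i
    proof -
      have "AE t in lebesgue_on (X i). \<bar>H i t\<bar> \<le> s i * K"
        using H[OF i] True by (simp add: Lp_bound_def)
      then show ?thesis
        by eventually_elim (use mult_right_mono[OF s_le[OF i] K] in linarith)
    qed
    then have "AE y in lebesgue. \<bar>patch H y\<bar> \<le> patch_const p s * K"
      using \<open>0 \<le> patch_const p s\<close> K by (intro AE_patch[OF meas]) auto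
    then show ?thesis using True pm by (simp add: Lp_bound_def)
  next
    case False
    let ?q = "enn2real p"
    have q: "1 \<le> ?q" using p False by (rule one_le_enn2real)
    have "(\<integral>\<^sup>+y. ennreal (\<bar>patch H y\<bar> powr ?q) \<partial>lebesgue) =
        (\<Sum>i\<in>I. ennreal \<bar>a i\<bar> * (\<integral>\<^sup>+t. ennreal (\<bar>H i t\<bar> powr ?q) \<partial>lebesgue_on (X i)))"
      by (rule nn_integral_patch[OF meas]) auto
    also have "\<dots> \<le> (\<Sum>i\<in>I. ennreal \<bar>a i\<bar> * ennreal ((s i * K) powr ?q))"
      using H False by (intro sum_mono mult_left_mono) (auto simp: Lp_bound_def)
    also have "\<dots> = ennreal (\<Sum>i\<in>I. \<bar>a i\<bar> * s i powr ?q * K powr ?q)"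
      using s K by (subst sum_ennreal[symmetric]) (auto simp: powr_mult mult.assoc ennreal_mult intro!: sum.cong)
    also have "(\<Sum>i\<in>I. \<bar>a i\<bar> * s i powr ?q * K powr ?q) = (patch_const p s * K) powr ?q"
      using False q K
      by (simp add: patch_const_def powr_mult powr_powr sum_nonneg flip: sum_distrib_right)
    finally show ?thesis using False pm by (simp add: Lp_bound_def)
  qed
qed

end

section \<open>The Read--Bajraktarevic operator\<close>

theorem theorem3p4:
  fixes p :: ennreal and N :: nat
    and X :: "nat \<Rightarrow> real set" and x :: "nat \<Rightarrow> real"
    and u l S :: "nat \<Rightarrow> real \<Rightarrow> real"
  defines "M \<equiv> lebesgue_on {0..1::real}"
    and "\<Phi> \<equiv> Read_Bajraktarevic N X u l S"
  assumes "1 \<le> p" and "1 < N"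
    and "\<And>i. i \<in> {1..N} \<Longrightarrow> half_open_interval (X i) \<and> X i \<subseteq> {0..1}"
    and "x 0 = 0" and "x N = 1" and "\<And>i. i < N \<Longrightarrow> x i < x (Suc i)"
    and "\<And>i. i \<in> {1..N} \<Longrightarrow> affine_map (u i)"
    and "\<And>i. i \<in> {1..N} \<Longrightarrow> u i ` X i = {x (i - 1)..<x i}"
    and "u N ` add_endpoint (X N) (u N) = {x (N - 1)..x N}"
    and "\<And>i. i \<in> {1..N} \<Longrightarrow> l i \<in> Lp_space (lebesgue_on (X i)) p"
    and "\<And>i. i \<in> {1..N} \<Longrightarrow> AE t in lebesgue_on (X i). l i t \<in> {0..1}"
    and "\<And>i. i \<in> {1..N} \<Longrightarrow> S i \<in> Lp_space (lebesgue_on (X i)) \<infinity>"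
  shows "(\<forall>g\<in>Lp_space M p. \<Phi> g \<in> Lp_space M p) \<and>
    (\<forall>g\<in>Lp_space M p. \<forall>h\<in>Lp_space M p.
       (AE t in M. g t = h t) \<longrightarrow> (AE t in M. \<Phi> g t = \<Phi> h t)) \<and>
    ((if p = \<infinity> then Max ((\<lambda>i. Lp_norm (lebesgue_on (X i)) \<infinity> (S i)) ` {1..N}) < 1
      else (\<Sum>i\<in>{1..N}. lipschitz_const (X i) (u i)
              * Lp_norm (lebesgue_on (X i)) \<infinity> (S i) powr enn2real p)
            powr (1 / enn2real p) < 1)
     \<longrightarrow> contractive_Lp M p \<Phi> \<and>
        (\<exists>f\<in>Lp_space M p. (AE t in M. \<Phi> f t = f t) \<and>
           (\<forall>h\<in>Lp_space M p. (AE t in M. \<Phi> h t = h t) \<longrightarrow> (AE t in M. h t = f t))))"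
proof -
  note p = assms(3) and N = assms(4) and X = assms(5)
    and x_less = assms(8) and aff = assms(9) and img = assms(10) and l = assms(12) and S = assms(14)
  obtain a b where ab: "u i t = a i * t + b i" if "i \<in> {1..N}" for i t
  proof -
    have "\<forall>i\<in>{1..N}. \<exists>a b. \<forall>t. u i t = a * t + b"
      using aff by (simp add: affine_map_def)
    then obtain a b where "\<forall>i\<in>{1..N}. \<forall>t. u i t = a i * t + b i"
      by (auto dest!: bchoice)
    then show thesis using that by blast
  qed
  have gap: "x (i - 1) < x i" if "i \<in> {1..N}" for i
    using x_less[of "i - 1"] that by (cases i) auto
  have x_mono: "x i \<le> x j" if "i \<le> j" "j \<le> N" for i j
    using that
  proof (induction j rule: dec_induct)
    case (step n)
    then show ?case using x_less[of n] by simp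
  qed simp
  have slope: "a i \<noteq> 0" if i: "i \<in> {1..N}" for i
  proof
    assume "a i = 0"
    then have "u i ` X i \<subseteq> {b i}" using ab[OF i] by auto
    moreover have "x (i - 1) \<in> u i ` X i" "(x (i - 1) + x i) / 2 \<in> u i ` X i"
      using gap[OF i] by (auto simp: img[OF i])
    ultimately have "x (i - 1) = b i" "(x (i - 1) + x i) / 2 = b i" by blast+
    then show False using gap[OF i] by simp
  qed
  \<comment> \<open>The slope can be read off the Lipschitz constant because \<open>X\<^sub>i\<close> is not a single point.\<close>
  have two_points: "\<exists>s\<in>X i. \<exists>t\<in>X i. s \<noteq> t" if i: "i \<in> {1..N}" for i
  proof -
    obtain c d where cd: "c < d" and Xi: "X i = {c..<d} \<or> X i = {c<..d}"
      using X[OF i] unfolding half_open_interval_def by blast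
    have sub: "{c<..<d} \<subseteq> X i"
      using Xi by (elim disjE ssubst) (auto intro: less_imp_le)
    obtain s where s: "c < s" "s < d" using dense[OF cd] by blast
    obtain t where t: "c < t" "t < s" using dense[OF s(1)] by blast
    have "s \<in> X i" "t \<in> X i" "s \<noteq> t" using s t sub by auto
    then show ?thesis by blast
  qed
  have X_sets: "X i \<in> sets lebesgue" if i: "i \<in> {1..N}" for i
    using X[OF i] by (auto simp: half_open_interval_def)
  interpret affine_pieces "{1..N}" X u a b
  proof
    show "disjoint_family_on (\<lambda>i. u i ` X i) {1..N}"
    proof -
      have "u i ` X i \<inter> u j ` X j = {}" if "i \<in> {1..N}" "j \<in> {1..N}" "i < j" for i j
      proof -
        have "x i \<le> x (j - 1)" using that by (intro x_mono) auto
        then show ?thesis unfolding img[OF that(1)] img[OF that(2)] by auto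
      qed
      then show ?thesis unfolding disjoint_family_on_def
        by (metis Int_commute linorder_neqE_nat)
    qed
  qed (use N ab slope X_sets in auto)
  have \<Phi>_patch: "\<Phi> g = patch (\<lambda>i t. l i t + S i t * g t)" for g
    unfolding \<Phi>_def Read_Bajraktarevic_def fun_eq_iff patch_def sum.distrib[symmetric] distrib_right
    by simp
  have \<Phi>_diff: "(\<lambda>y. \<Phi> g y - \<Phi> h y) = patch (\<lambda>i t. S i t * (g t - h t))" for g h
    unfolding \<Phi>_patch fun_eq_iff patch_def sum_subtractf[symmetric] left_diff_distrib[symmetric]
    by (simp add: right_diff_distrib)
  \<comment> \<open>The terms \<open>\<lambda>\<^sub>i\<close> cancel in differences, so only \<open>\<parallel>S\<^sub>i\<parallel>\<^sub>\<infinity>\<close> and the slopes enter the Lipschitz bound.\<close>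
  define \<sigma> where "\<sigma> i = Lp_norm (lebesgue_on (X i)) \<infinity> (S i)" for i
  have \<sigma>_nonneg: "0 \<le> \<sigma> i" for i by (simp add: \<sigma>_def Lp_norm_nonneg)
  have S_bound: "S i \<in> borel_measurable (lebesgue_on (X i))"
      "AE t in lebesgue_on (X i). \<bar>S i t\<bar> \<le> \<sigma> i" if "i \<in> {1..N}" for i
    using Lp_bound_norm[OF _ S[OF that]] by (auto simp: Lp_bound_def \<sigma>_def)
  have S_mult: "Lp_bound (lebesgue_on (X i)) p (\<lambda>t. S i t * d t) (\<sigma> i * K)"
    if i: "i \<in> {1..N}" and d: "Lp_bound M p d K" "0 \<le> K" for i d K
  proof -
    have "Lp_bound (lebesgue_on (X i)) p d K"
      using X[OF i] by (intro Lp_bound_restrict_mono[OF d(1)[unfolded M_def] _ X_sets[OF i]]) auto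
    then show ?thesis by (rule Lp_bound_mult[OF p S_bound[OF i] \<sigma>_nonneg _ d(2)])
  qed
  have to_M: "Lp_bound M p f K" if "Lp_bound lebesgue p f K" for f K
    using Lp_bound_restrict_mono[of lebesgue UNIV p f K "{0..1}"] that
    by (simp add: M_def lebesgue_on_UNIV_eq)
  let ?c = "patch_const p \<sigma>"
  have lip: "Lp_bound M p (\<lambda>y. \<Phi> g y - \<Phi> h y) (?c * K)"
    if "Lp_bound M p (\<lambda>t. g t - h t) K" "0 \<le> K" for g h K
    unfolding \<Phi>_diff
    by (rule to_M, rule Lp_bound_patch[OF p S_mult[OF _ that] \<sigma>_nonneg that(2)])
  have c_nonneg: "0 \<le> ?c" by (rule patch_const_nonneg) (rule \<sigma>_nonneg)
  have maps: "\<Phi> g \<in> Lp_space M p" if g: "g \<in> Lp_space M p" for g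
  proof -
    define s where "s i = Lp_norm (lebesgue_on (X i)) p (l i) + \<sigma> i * Lp_norm M p g" for i
    have s: "0 \<le> s i" for i by (simp add: s_def \<sigma>_nonneg Lp_norm_nonneg)
    have "Lp_bound (lebesgue_on (X i)) p (\<lambda>t. l i t + S i t * g t) (s i * 1)" if "i \<in> {1..N}" for i
      unfolding s_def mult_1_right
      using that by (intro Lp_bound_add[OF p] Lp_bound_norm[OF p] l S_mult g)
        (auto simp: \<sigma>_nonneg Lp_norm_nonneg)
    then have "Lp_bound M p (\<Phi> g) (patch_const p s * 1)"
      unfolding \<Phi>_patch by (rule to_M[OF Lp_bound_patch[OF p _ s zero_le_one]])
    then show ?thesis using patch_const_nonneg[of s p] s by (auto simp: Lp_space_iff_bound[OF p])
  qed
  have welldef: "AE t in M. \<Phi> g t = \<Phi> h t"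
    if "g \<in> Lp_space M p" "h \<in> Lp_space M p" "AE t in M. g t = h t" for g h
  proof -
    have "Lp_bound M p (\<lambda>t. g t - h t) 0"
      using that by (auto simp: Lp_bound_0_iff[OF p] Lp_space_def)
    then have "Lp_bound M p (\<lambda>t. \<Phi> g t - \<Phi> h t) 0" using lip[of g h 0] by simp
    then show ?thesis by (simp add: Lp_bound_0_iff[OF p])
  qed
  have contr: "contractive_Lp M p \<Phi>" if "?c < 1"
    unfolding contractive_Lp_def
  proof (intro exI[of _ ?c] conjI ballI c_nonneg that)
    fix g h assume "g \<in> Lp_space M p" "h \<in> Lp_space M p"
    then have "Lp_bound M p (\<lambda>y. \<Phi> g y - \<Phi> h y) (?c * Lp_norm M p (\<lambda>t. g t - h t))"
      by (intro lip Lp_bound_norm[OF p] Lp_space_diff[OF p] Lp_norm_nonneg)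
    then show "Lp_norm M p (\<lambda>y. \<Phi> g y - \<Phi> h y) \<le> ?c * Lp_norm M p (\<lambda>t. g t - h t)"
      using c_nonneg by (simp add: Lp_bound_iff_norm[OF p] Lp_norm_nonneg)
  qed
  have "lipschitz_const (X i) (u i) = \<bar>a i\<bar>" if "i \<in> {1..N}" for i
    using two_points[OF that] lipschitz_const_affine[OF ab[OF that]] by blast
  then have c_eq: "(if p = \<infinity> then Max ((\<lambda>i. Lp_norm (lebesgue_on (X i)) \<infinity> (S i)) ` {1..N})
      else (\<Sum>i\<in>{1..N}. lipschitz_const (X i) (u i)
              * Lp_norm (lebesgue_on (X i)) \<infinity> (S i) powr enn2real p)
            powr (1 / enn2real p)) = ?c"
    unfolding patch_const_def \<sigma>_def[abs_def] by simp
  show ?thesis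
    using maps welldef contr contractive_Lp_fixed_point[OF p maps contr] c_eq
    by (simp split: if_splits)
qed

end
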